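(* Let $\mathbb{K}$ be a good topological ring, let $U,U',U''$ be open in topological $\mathbb{K}$-modules $V,V',V''$, respectively, and let $g:U'\to U''$ and $f:U\to U'$ be maps. If $g$ and $f$ are of class $C^1$ over $\mathbb{K}$, then so is $g\circ f$, and we have the chain rule $$(g\circ f)^{\{1\}}=g^{\{1\}}\circ f^{\{1\}},$$ or, equivalently, for all $t\in\mathbb{K}$: $(g\circ f)^{\{1\}}_t=g^{\{1\}}_t\circ f^{\{1\}}_t$. In particular, $T(g\circ f)=Tg\circ Tf$.
   Context: A good topological ring is a (unital, Hausdorff) topological ring whose unit group $\mathbb{K}^\times$ is dense; topological modules are Hausdorff. For $U\subset V$ open, $U^{[1]}:=\{(x,v,t)\in V\times V\times\mathbb{K}\mid x\in U,\ x+tv\in U\}$ and $U_t:=\{(x,v)\mid(x,v,t)\in U^{[1]}\}$. A map $f:U\to U'\subset V'$ is of class $C^1$ over $\mathbb{K}$ if there is a continuous map $f^{[1]}:U^{[1]}\to V'$ with $f^{[1]}(x,v,t)=t^{-1}(f(x+tv)-f(x))$ whenever $t\in\mathbb{K}^\times$ (it is then unique). In that case $f^{\{1\}}:U^{[1]}\to(U')^{[1]}$ is $f^{\{1\}}(x,v,t)=(f(x),f^{[1]}(x,v,t),t)$ (together with $f\times\mathrm{id}_{\mathbb{K}}:U\times\mathbb{K}\to U'\times\mathbb{K}$ on objects of the tangent groupoids), $f^{\{1\}}_t:U_t\to U'_t$ is $f^{\{1\}}_t(x,v)=(f(x),f^{[1]}(x,v,t))$, and $Tf:=f^{\{1\}}_0:U\times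 V\to U'\times V'$. *)

theory Defs
  imports "HOL-Analysis.Analysis"
begin

definition (in monoid_mult) ring_units :: "'a set" where
  "ring_units = {a. \<exists>b. a * b = 1 \<and> b * a = 1}"

definition (in monoid_mult) ring_inverse :: "'a \<Rightarrow> 'a" where
  "ring_inverse a = (THE b. a * b = 1 \<and> b * a = 1)"

(* Rings are unital but not assumed commutative.  The class is built from ring and monoid_mult
   rather than ring_1, so that the zero ring is not excluded. *)
class topological_ring = ring + topological_ab_group_add + topological_monoid_mult + t2_space

class good_topological_ring = topological_ring +
  assumes ring_units_meet_open: "open S \<Longrightarrow> S \<noteq> {} \<Longrightarrow> S \<inter> ring_units \<noteq> {}"

lemma ring_units_dense: "closure (ring_units :: 'k::good_topological_ring set) = UNIV"
proof -
  have "a \<in> closure ring_units" for a :: 'k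
    unfolding closure_iff_nhds_not_empty using ring_units_meet_open by blast
  then show ?thesis by blast
qed

(* HOL.Modules.module requires commutative scalars, hence this locale of Hausdorff
   topological left modules. *)
locale topological_module =
  fixes scale :: "'k::good_topological_ring \<Rightarrow> 'v::{topological_ab_group_add,t2_space} \<Rightarrow> 'v"
  assumes scale_add_right: "scale a (x + y) = scale a x + scale a y"
    and scale_add_left: "scale (a + b) x = scale a x + scale b x"
    and scale_scale: "scale a (scale b x) = scale (a * b) x"
    and scale_one: "scale 1 x = x"
    and continuous_scale: "continuous_on UNIV (\<lambda>(a, x). scale a x)"

(* U^[1] *)
definition dom1 :: "('k \<Rightarrow> 'v \<Rightarrow> 'v::plus) \<Rightarrow> 'v set \<Rightarrow> ('v \<times> 'v \<times> 'k) set" where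
  "dom1 s U = {(x, v, t). x \<in> U \<and> x + s t v \<in> U}"

(* U_t *)
definition dom1_at :: "('k \<Rightarrow> 'v \<Rightarrow> 'v::plus) \<Rightarrow> 'v set \<Rightarrow> 'k \<Rightarrow> ('v \<times> 'v) set" where
  "dom1_at s U t = {(x, v). (x, v, t) \<in> dom1 s U}"

definition is_slope ::
  "('k::good_topological_ring \<Rightarrow> 'v::{topological_ab_group_add,t2_space} \<Rightarrow> 'v) \<Rightarrow>
   ('k \<Rightarrow> 'w::{topological_ab_group_add,t2_space} \<Rightarrow> 'w) \<Rightarrow>
   'v set \<Rightarrow> ('v \<Rightarrow> 'w) \<Rightarrow> ('v \<times> 'v \<times> 'k \<Rightarrow> 'w) \<Rightarrow> bool" where
  "is_slope s s' U f F \<longleftrightarrow>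
     continuous_on (dom1 s U) F \<and>
     (\<forall>x v t. (x, v, t) \<in> dom1 s U \<longrightarrow> t \<in> ring_units \<longrightarrow>
        F (x, v, t) = s' (ring_inverse t) (f (x + s t v) - f x))"

(* A map U \<rightarrow> U' is a total function sending U into U'; its values off U are irrelevant. *)
definition C1_map ::
  "('k::good_topological_ring \<Rightarrow> 'v::{topological_ab_group_add,t2_space} \<Rightarrow> 'v) \<Rightarrow>
   ('k \<Rightarrow> 'w::{topological_ab_group_add,t2_space} \<Rightarrow> 'w) \<Rightarrow>
   'v set \<Rightarrow> 'w set \<Rightarrow> ('v \<Rightarrow> 'w) \<Rightarrow> bool" where
  "C1_map s s' U U' f \<longleftrightarrow> f \<in> U \<rightarrow> U' \<and> (\<exists>F. is_slope s s' U f F)"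

(* f^[1].  Extensionality pins down the irrelevant values off U^[1], so that the description
   is meaningful whenever f is of class C^1 (see is_slope_unique). *)
definition slope ::
  "('k::good_topological_ring \<Rightarrow> 'v::{topological_ab_group_add,t2_space} \<Rightarrow> 'v) \<Rightarrow>
   ('k \<Rightarrow> 'w::{topological_ab_group_add,t2_space} \<Rightarrow> 'w) \<Rightarrow>
   'v set \<Rightarrow> ('v \<Rightarrow> 'w) \<Rightarrow> 'v \<times> 'v \<times> 'k \<Rightarrow> 'w" where
  "slope s s' U f = (THE F. F \<in> extensional (dom1 s U) \<and> is_slope s s' U f F)"

(* f^{1} on the morphisms U^[1] of the tangent groupoid *)
definition tangent_mor ::
  "('k::good_topological_ring \<Rightarrow> 'v::{topological_ab_group_add,t2_space} \<Rightarrow> 'v) \<Rightarrow>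
   ('k \<Rightarrow> 'w::{topological_ab_group_add,t2_space} \<Rightarrow> 'w) \<Rightarrow>
   'v set \<Rightarrow> ('v \<Rightarrow> 'w) \<Rightarrow> 'v \<times> 'v \<times> 'k \<Rightarrow> 'w \<times> 'w \<times> 'k" where
  "tangent_mor s s' U f = (\<lambda>(x, v, t). (f x, slope s s' U f (x, v, t), t))"

(* f^{1} on the objects U \<times> K of the tangent groupoid *)
definition tangent_obj :: "('v \<Rightarrow> 'w) \<Rightarrow> 'v \<times> 'k \<Rightarrow> 'w \<times> 'k" where
  "tangent_obj f = map_prod f id"

(* f^{1}_t *)
definition tangent_at ::
  "('k::good_topological_ring \<Rightarrow> 'v::{topological_ab_group_add,t2_space} \<Rightarrow> 'v) \<Rightarrow>
   ('k \<Rightarrow> 'w::{topological_ab_group_add,t2_space} \<Rightarrow> 'w) \<Rightarrow>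
   'v set \<Rightarrow> ('v \<Rightarrow> 'w) \<Rightarrow> 'k \<Rightarrow> 'v \<times> 'v \<Rightarrow> 'w \<times> 'w" where
  "tangent_at s s' U f t = (\<lambda>(x, v). (f x, slope s s' U f (x, v, t)))"

(* Tf *)
definition tangent_map ::
  "('k::good_topological_ring \<Rightarrow> 'v::{topological_ab_group_add,t2_space} \<Rightarrow> 'v) \<Rightarrow>
   ('k \<Rightarrow> 'w::{topological_ab_group_add,t2_space} \<Rightarrow> 'w) \<Rightarrow>
   'v set \<Rightarrow> ('v \<Rightarrow> 'w) \<Rightarrow> 'v \<times> 'v \<Rightarrow> 'w \<times> 'w" where
  "tangent_map s s' U f = tangent_at s s' U f 0"

lemma is_slope_unique:
  fixes s :: "'k::good_topological_ring \<Rightarrow> 'v::{topological_ab_group_add,t2_space} \<Rightarrow> 'v"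
    and s' :: "'k \<Rightarrow> 'w::{topological_ab_group_add,t2_space} \<Rightarrow> 'w"
  assumes "topological_module s" and "open U"
    and F: "is_slope s s' U f F" and G: "is_slope s s' U f G" and p: "p \<in> dom1 s U"
  shows "F p = G p"
proof -
  obtain x v t where [simp]: "p = (x, v, t)" by (cases p)
  define h where "h = (\<lambda>r::'k. (x, v, r))"
  have h: "continuous_on UNIV h"
    unfolding h_def by (intro continuous_intros)
  have "continuous_on UNIV (\<lambda>r. s r v)"
    using continuous_on_compose2[OF topological_module.continuous_scale[OF assms(1)],
        of UNIV "\<lambda>r. (r, v)"]
    by (simp add: continuous_on_Pair continuous_on_const continuous_on_id)
  then have "continuous_on UNIV (\<lambda>r. x + s r v)"
    by (intro continuous_intros)
  then have op: "open ((\<lambda>r. x + s r v) -` U)"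
    using \<open>open U\<close> by (simp add: open_vimage)
  define A where "A = (\<lambda>r. x + s r v) -` U"
  have A: "open A" "t \<in> A" "h ` A \<subseteq> dom1 s U"
    using op p by (auto simp: A_def h_def dom1_def)
  have FG: "continuous_on A (\<lambda>r. F (h r))" "continuous_on A (\<lambda>r. G (h r))"
    using F G A(3) h unfolding is_slope_def
    by (auto intro: continuous_on_compose2 continuous_on_subset)
  have eq: "F (h r) = G (h r)" if "r \<in> A" "r \<in> ring_units" for r
    using F G that A(3) unfolding is_slope_def h_def by (metis image_subset_iff)
  have "F (h t) = G (h t)"
  proof (rule ccontr)
    assume "F (h t) \<noteq> G (h t)"
    then obtain M N where MN: "open M" "open N" "F (h t) \<in> M" "G (h t) \<in> N" "M \<inter> N = {}"
      by (metis hausdorff)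
    have "open ((\<lambda>r. F (h r)) -` M \<inter> A)" "open ((\<lambda>r. G (h r)) -` N \<inter> A)"
      using FG A(1) MN(1,2) by (auto simp: continuous_on_open_vimage)
    then have "open (((\<lambda>r. F (h r)) -` M \<inter> A) \<inter> ((\<lambda>r. G (h r)) -` N \<inter> A))"
      by blast
    moreover have "t \<in> ((\<lambda>r. F (h r)) -` M \<inter> A) \<inter> ((\<lambda>r. G (h r)) -` N \<inter> A)"
      using MN A by auto
    moreover have "t \<in> closure ring_units"
      by (simp add: ring_units_dense)
    ultimately obtain r where "r \<in> ring_units" "r \<in> ((\<lambda>r. F (h r)) -` M \<inter> A) \<inter> ((\<lambda>r. G (h r)) -` N \<inter> A)"
      by (meson closure_iff_nhds_not_empty disjoint_iff subset_refl)
    then show False using eq[of r] MN(5) by auto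
  qed
  then show ?thesis by (simp add: h_def)
qed

end

theory Submission
  imports Defs
begin

text \<open>
  A slope \<open>F\<close> of \<open>f\<close> is prescribed by the quotient \<open>t\<inverse> (f (x + t v) - f x)\<close> only for
  invertible \<open>t\<close>. The chain rule rests on the division-free form of this equation,
  \<open>f (x + t v) = f x + t F (x, v, t)\<close>, which holds for every \<open>t\<close>, in particular for \<open>t = 0\<close>
  (\<open>is_slope_increment\<close>). For invertible \<open>t\<close> it is the definition. Taking \<open>t = 1\<close> there already
  shows that \<open>f\<close> is continuous, because \<open>f y = f x + F (x, y - x, 1)\<close> (\<open>is_slope_continuous\<close>). Both
  sides are then continuous in \<open>t\<close>, and as the units are dense and the modules Hausdorff, the
  equation extends to all \<open>t\<close>.

  Consequently \<open>f x + t F (x, v, t)\<close> lies in \<open>U'\<close> together with \<open>f (x + t v)\<close>, so that the slope \<open>G\<close>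
  of \<open>g\<close> may be evaluated at \<open>(f x, F (x, v, t), t)\<close>. This gives a continuous map, and for
  invertible \<open>t\<close> its value is
  \<open>t\<inverse> (g (f x + t F (x, v, t)) - g (f x)) = t\<inverse> (g (f (x + t v)) - g (f x))\<close>.
  Hence it is a slope of \<open>g \<circ> f\<close> (\<open>is_slope_comp\<close>). By uniqueness of slopes it is the slope, and
  this one equation is the chain rule on all of \<open>U\<^sup>[\<^sup>1\<^sup>]\<close>, for fixed \<open>t\<close>, and, at \<open>t = 0\<close>, for the
  tangent map.
\<close>

lemma ring_units_right_inverse:
  assumes "t \<in> ring_units"
  shows "t * ring_inverse t = (1::'a::monoid_mult)"
proof -
  obtain b where b: "t * b = 1" "b * t = 1"
    using assms by (auto simp: ring_units_def)
  have "c = b" if "t * c = 1 \<and> c * t = 1" for c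
    using that b by (metis mult.assoc mult_1_left mult_1_right)
  with b have "t * ring_inverse t = 1 \<and> ring_inverse t * t = 1"
    unfolding ring_inverse_def by (intro theI[of "\<lambda>c. t * c = 1 \<and> c * t = 1"]) auto
  then show ?thesis by blast
qed

lemma one_in_ring_units: "(1::'a::monoid_mult) \<in> ring_units"
  by (auto simp: ring_units_def)

text \<open>
  The set where the two maps differ is open, since the diagonal of a Hausdorff space is closed; if it
  were nonempty, it would contain a unit.
\<close>
lemma continuous_on_eq_from_units:
  fixes p q :: "'k::good_topological_ring \<Rightarrow> 'a::t2_space"
  assumes "open A" and "continuous_on A p" and "continuous_on A q"
    and units: "\<And>r. r \<in> A \<Longrightarrow> r \<in> ring_units \<Longrightarrow> p r = q r"
    and "t \<in> A"
  shows "p t = q t"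
proof (rule ccontr)
  assume "p t \<noteq> q t"
  define D where "D = (\<lambda>r. (p r, q r)) -` {z. fst z \<noteq> snd z} \<inter> A"
  have "continuous_on A (\<lambda>r. (p r, q r))"
    using assms by (intro continuous_intros)
  moreover have "open {z :: 'a \<times> 'a. fst z \<noteq> snd z}"
    by (intro open_Collect_neq continuous_intros)
  ultimately have "open D"
    unfolding D_def using \<open>open A\<close> continuous_on_open_vimage by blast
  moreover have "t \<in> D"
    using \<open>p t \<noteq> q t\<close> \<open>t \<in> A\<close> by (simp add: D_def)
  ultimately obtain r where "r \<in> D" "r \<in> ring_units"
    using ring_units_meet_open by blast
  then show False
    using units by (auto simp: D_def)
qed

lemma (in topological_module) scale_zero_left: "scale 0 x = 0"
  using scale_add_left[of 0 0 x] by simp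

lemma (in topological_module) continuous_on_scale:
  assumes "continuous_on A p" and "continuous_on A q"
  shows "continuous_on A (\<lambda>r. scale (p r) (q r))"
  using continuous_on_compose2[OF continuous_scale continuous_on_Pair[OF assms]] by simp

lemma is_slope_continuous_slope: "is_slope s s' U f F \<Longrightarrow> continuous_on (dom1 s U) F"
  by (simp add: is_slope_def)

lemma is_slope_increment_unit:
  assumes "topological_module s'" and "is_slope s s' U f F"
    and "(x, v, t) \<in> dom1 s U" and "t \<in> ring_units"
  shows "f (x + s t v) = f x + s' t (F (x, v, t))"
proof -
  interpret s': topological_module s' by fact
  have "F (x, v, t) = s' (ring_inverse t) (f (x + s t v) - f x)"
    using assms by (simp add: is_slope_def)
  then show ?thesis
    using assms(4) by (simp add: s'.scale_scale s'.scale_one ring_units_right_inverse)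
qed

text \<open>
  Every point of \<open>U\<close> is reached from a fixed \<open>x\<close> with parameter \<open>t = 1\<close>, so continuity of the slope
  in its second argument alone makes \<open>f\<close> continuous on all of \<open>U\<close>.
\<close>
lemma is_slope_continuous:
  fixes s :: "'k::good_topological_ring \<Rightarrow> 'v::{topological_ab_group_add,t2_space} \<Rightarrow> 'v"
  assumes "topological_module s" and "topological_module s'" and F: "is_slope s s' U f F"
  shows "continuous_on U f"
proof (cases "U = {}")
  case False
  then obtain x where x: "x \<in> U" by blast
  interpret s: topological_module s by fact
  interpret s': topological_module s' by fact
  have dom: "(x, y - x, 1) \<in> dom1 s U" if "y \<in> U" for y
    using x that by (simp add: dom1_def s.scale_one)
  have "continuous_on U (\<lambda>y. F (x, y - x, 1))"
    by (rule continuous_on_compose2[OF is_slope_continuous_slope[OF F]])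
      (use dom in \<open>auto intro!: continuous_intros\<close>)
  then have "continuous_on U (\<lambda>y. f x + F (x, y - x, 1))"
    by (intro continuous_intros)
  moreover have "f x + F (x, y - x, 1) = f y" if "y \<in> U" for y
    using is_slope_increment_unit[OF assms(2) F dom[OF that] one_in_ring_units]
    by (simp add: s.scale_one s'.scale_one)
  ultimately show ?thesis
    by (simp cong: continuous_on_cong)
qed simp

text \<open>
  With \<open>x\<close> and \<open>v\<close> fixed, both sides are continuous in \<open>t\<close> on the open set where \<open>x + t v \<in> U\<close>, and
  they agree at its units, which are dense in it.
\<close>
lemma is_slope_increment:
  fixes s :: "'k::good_topological_ring \<Rightarrow> 'v::{topological_ab_group_add,t2_space} \<Rightarrow> 'v"
  assumes s: "topological_module s" and s': "topological_module s'" and "open U"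
    and F: "is_slope s s' U f F" and p: "(x, v, t) \<in> dom1 s U"
  shows "f (x + s t v) = f x + s' t (F (x, v, t))"
proof -
  interpret s: topological_module s by fact
  interpret s': topological_module s' by fact
  define A where "A = (\<lambda>r. x + s r v) -` U"
  have line: "continuous_on B (\<lambda>r. x + s r v)" for B
    by (intro continuous_intros s.continuous_on_scale)
  have "open A"
    unfolding A_def using line \<open>open U\<close> by (simp add: open_vimage)
  have dom: "(x, v, r) \<in> dom1 s U" if "r \<in> A" for r
    using p that by (simp add: A_def dom1_def)
  have "continuous_on A (\<lambda>r. f (x + s r v))"
    by (rule continuous_on_compose2[OF is_slope_continuous[OF s s' F] line]) (auto simp: A_def)
  moreover have "continuous_on A (\<lambda>r. F (x, v, r))"
    by (rule continuous_on_compose2[OF is_slope_continuous_slope[OF F]])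
      (use dom in \<open>auto intro!: continuous_intros\<close>)
  then have "continuous_on A (\<lambda>r. f x + s' r (F (x, v, r)))"
    by (intro continuous_intros s'.continuous_on_scale)
  moreover have "f (x + s r v) = f x + s' r (F (x, v, r))" if "r \<in> A" "r \<in> ring_units" for r
    using is_slope_increment_unit[OF s' F dom] that by blast
  moreover have "t \<in> A"
    using p by (simp add: A_def dom1_def)
  ultimately show ?thesis
    using \<open>open A\<close> continuous_on_eq_from_units by blast
qed

text \<open>
  Membership requires \<open>f x + t F (x, v, t) \<in> U'\<close>. At a non-invertible \<open>t\<close> this rests on the density
  argument above, which identifies that point with \<open>f (x + t v)\<close>.
\<close>
lemma is_slope_maps_to_dom1:
  assumes "topological_module s" and "topological_module s'" and "open U"
    and "is_slope s s' U f F" and "f \<in> U \<rightarrow> U'" and "(x, v, t) \<in> dom1 s U"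
  shows "(f x, F (x, v, t), t) \<in> dom1 s' U'"
  using assms is_slope_increment[OF assms(1-4,6)] by (auto simp: dom1_def Pi_iff)

lemma is_slope_comp:
  fixes s :: "'k::good_topological_ring \<Rightarrow> 'v::{topological_ab_group_add,t2_space} \<Rightarrow> 'v"
  assumes s: "topological_module s" and s': "topological_module s'" and U: "open U"
    and F: "is_slope s s' U f F" and f: "f \<in> U \<rightarrow> U'" and G: "is_slope s' s'' U' g G"
  shows "is_slope s s'' U (g \<circ> f) (\<lambda>(x, v, t). G (f x, F (x, v, t), t))"
proof -
  note dom = is_slope_maps_to_dom1[OF s s' U F f]
  have "continuous_on (dom1 s U) (\<lambda>p. f (fst p))"
    by (rule continuous_on_compose2[OF is_slope_continuous[OF s s' F]])
      (auto intro!: continuous_intros simp: dom1_def)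
  moreover have "continuous_on (dom1 s U) F"
    using F by (rule is_slope_continuous_slope)
  ultimately have "continuous_on (dom1 s U) (\<lambda>p. (f (fst p), F p, snd (snd p)))"
    by (intro continuous_intros)
  then have "continuous_on (dom1 s U) (\<lambda>p. G (f (fst p), F p, snd (snd p)))"
    by (rule continuous_on_compose2[OF is_slope_continuous_slope[OF G]]) (use dom in auto)
  moreover have "G (f x, F (x, v, t), t) =
      s'' (ring_inverse t) ((g \<circ> f) (x + s t v) - (g \<circ> f) x)"
    if "(x, v, t) \<in> dom1 s U" "t \<in> ring_units" for x v t
    using G dom that is_slope_increment[OF s s' U F, of x v t] by (simp add: is_slope_def)
  ultimately show ?thesis
    by (simp add: is_slope_def case_prod_beta')
qed

text \<open>
  Uniqueness of slopes only concerns their values on \<open>U\<^sup>[\<^sup>1\<^sup>]\<close>, so restricting any slope to it gives the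
  one extensional slope that the definite description denotes.
\<close>
lemma slope_eqI:
  fixes s :: "'k::good_topological_ring \<Rightarrow> 'v::{topological_ab_group_add,t2_space} \<Rightarrow> 'v"
  assumes "topological_module s" and "open U" and F: "is_slope s s' U f F" and p: "p \<in> dom1 s U"
  shows "slope s s' U f p = F p"
proof -
  have "slope s s' U f = restrict F (dom1 s U)"
    unfolding slope_def
  proof (rule the_equality)
    show "restrict F (dom1 s U) \<in> extensional (dom1 s U)
        \<and> is_slope s s' U f (restrict F (dom1 s U))"
      using F by (auto simp: is_slope_def cong: continuous_on_cong)
  next
    fix G assume G: "G \<in> extensional (dom1 s U) \<and> is_slope s s' U f G"
    then show "G = restrict F (dom1 s U)"
      using is_slope_unique[OF assms(1,2) _ F]
      by (intro extensionalityI[of _ "dom1 s U"]) auto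
  qed
  with p show ?thesis by simp
qed

lemma C1_map_is_slope_slope:
  fixes s :: "'k::good_topological_ring \<Rightarrow> 'v::{topological_ab_group_add,t2_space} \<Rightarrow> 'v"
  assumes "topological_module s" and "open U" and "C1_map s s' U U' f"
  shows "is_slope s s' U f (slope s s' U f)"
proof -
  obtain F where F: "is_slope s s' U f F"
    using assms by (auto simp: C1_map_def)
  with slope_eqI[OF assms(1,2) F] show ?thesis
    by (simp add: is_slope_def cong: continuous_on_cong)
qed

theorem theorem2p10:
  fixes s :: "'k::good_topological_ring \<Rightarrow> 'v::{topological_ab_group_add,t2_space} \<Rightarrow> 'v"
    and s' :: "'k \<Rightarrow> 'w::{topological_ab_group_add,t2_space} \<Rightarrow> 'w"
    and s'' :: "'k \<Rightarrow> 'z::{topological_ab_group_add,t2_space} \<Rightarrow> 'z"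
    and U :: "'v set" and U' :: "'w set" and U'' :: "'z set"
    and f :: "'v \<Rightarrow> 'w" and g :: "'w \<Rightarrow> 'z"
  assumes "topological_module s" and "topological_module s'" and "topological_module s''"
    and "open U" and "open U'" and "open U''"
    and "C1_map s' s'' U' U'' g" and "C1_map s s' U U' f"
  shows "C1_map s s'' U U'' (g \<circ> f)
    \<and> tangent_mor s s' U f \<in> dom1 s U \<rightarrow> dom1 s' U'
    \<and> (\<forall>p \<in> dom1 s U.
        tangent_mor s s'' U (g \<circ> f) p = (tangent_mor s' s'' U' g \<circ> tangent_mor s s' U f) p)
    \<and> (\<forall>q \<in> U \<times> (UNIV :: 'k set). tangent_obj (g \<circ> f) q = (tangent_obj g \<circ> tangent_obj f) q)
    \<and> (\<forall>t. \<forall>p \<in> dom1_at s U t.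
        tangent_at s s'' U (g \<circ> f) t p = (tangent_at s' s'' U' g t \<circ> tangent_at s s' U f t) p)
    \<and> (\<forall>p \<in> U \<times> UNIV.
        tangent_map s s'' U (g \<circ> f) p = (tangent_map s' s'' U' g \<circ> tangent_map s s' U f) p)"
proof -
  note s = assms(1) and s' = assms(2) and U = assms(4) and U' = assms(5)
  interpret s: topological_module s by (fact s)
  have maps: "f \<in> U \<rightarrow> U'" "g \<in> U' \<rightarrow> U''"
    using assms(7,8) by (auto simp: C1_map_def)
  note F = C1_map_is_slope_slope[OF s U assms(8)]
  note G = C1_map_is_slope_slope[OF s' U' assms(7)]
  note comp = is_slope_comp[OF s s' U F maps(1) G]
  have C1: "C1_map s s'' U U'' (g \<circ> f)"
    unfolding C1_map_def using comp maps by (auto simp: Pi_iff)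
  have chain: "slope s s'' U (g \<circ> f) (x, v, t) = slope s' s'' U' g (f x, slope s s' U f (x, v, t), t)"
    if "(x, v, t) \<in> dom1 s U" for x v t
    using slope_eqI[OF s U comp that] by simp
  have zero: "(x, v, 0) \<in> dom1 s U" if "x \<in> U" for x v
    using that by (simp add: dom1_def s.scale_zero_left)
  show ?thesis
    using C1 chain zero is_slope_maps_to_dom1[OF s s' U F maps(1)]
    by (auto simp: tangent_mor_def tangent_obj_def tangent_map_def tangent_at_def dom1_at_def)
qed

end
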